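(* Every $2\times n$ transportation polytope $P$ (degenerate or not) satisfies $\mathcal{CD}_{fm}(P)\leq n-1$.
   Context: For $u\in\mathbb{R}^2_{>0}$, $v\in\mathbb{R}^n_{>0}$ with $u_1+u_2=\sum_j v_j$, the $2\times n$ transportation polytope is $P=\{y\in\mathbb{R}^{2\times n}: \sum_j y_{ij}=u_i,\ \sum_i y_{ij}=v_j,\ y\ge 0\}$. Its circuits are the vectors obtained from simple even cycles in $K_{2,n}$ (supply nodes $\mathfrak{s}_1,\mathfrak{s}_2$, demand nodes $\mathfrak{d}_j$, edge $\{\mathfrak{s}_i,\mathfrak{d}_j\}$ corresponding to $y_{ij}$) by alternately assigning $+1$ and $-1$ along the cycle; equivalently the support-minimal nonzero integer vectors in the kernel of the constraint matrix. A feasible maximal circuit walk between vertices $w^{(1)},w^{(2)}$ is a sequence $w^{(1)}=y^{(0)},\ldots,y^{(k)}=w^{(2)}$ with $y^{(i+1)}=y^{(i)}+\alpha_i g^i$, $g^i$ a circuit, $\alpha_i>0$, every $y^{(i)}\in P$, and each step maximal: $y^{(i)}+\alpha g^i\notin P$ for all $\alpha>\alpha_i$. $\mathcal{CD}_{fm}$ between two vertices is the minimal length of such a walk, and $\mathcal{CD}_{fm}(P)$ is the maximum over all pairs of vertices. *)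

theory Defs
  imports "HOL-Analysis.Analysis"
begin

definition transportation_polytope :: "real^'m \<Rightarrow> real^'n \<Rightarrow> (real^'n^'m) set" where
  "transportation_polytope u v =
     {y. (\<forall>i. (\<Sum>j\<in>UNIV. y $ i $ j) = u $ i) \<and>
         (\<forall>j. (\<Sum>i\<in>UNIV. y $ i $ j) = v $ j) \<and>
         (\<forall>i j. 0 \<le> y $ i $ j)}"

datatype ('m, 'n) node = Supply 'm | Demand 'n

definition bipartite_edges :: "('m, 'n) node set set" where
  "bipartite_edges = {{Supply i, Demand j} | i j. True}"

text \<open>A simple cycle is given by the list of its nodes, without repeating the first node at the
  end; the \<open>k\<close>-th edge joins entry \<open>k\<close> to its cyclic successor.\<close>

definition cycle_edge :: "('m, 'n) node list \<Rightarrow> nat \<Rightarrow> ('m, 'n) node set" where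
  "cycle_edge c k = {c ! k, c ! (Suc k mod length c)}"

definition simple_even_cycle :: "('m, 'n) node list \<Rightarrow> bool" where
  "simple_even_cycle c \<longleftrightarrow>
     3 \<le> length c \<and> even (length c) \<and> distinct c \<and>
     (\<forall>k<length c. cycle_edge c k \<in> bipartite_edges)"

text \<open>Both sign patterns on a cycle arise, since the node list may be rotated by one position.\<close>

definition alternating_vector :: "('m, 'n) node list \<Rightarrow> real^'n^'m" where
  "alternating_vector c =
     (\<chi> i j. \<Sum>k<length c. if cycle_edge c k = {Supply i, Demand j} then (-1) ^ k else 0)"

definition circuits :: "(real^'n^'m) set" where
  "circuits = {alternating_vector c | c. simple_even_cycle c}"

definition maximal_circuit_step ::
    "(real^'n^'m) set \<Rightarrow> real^'n^'m \<Rightarrow> real^'n^'m \<Rightarrow> bool" where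
  "maximal_circuit_step P y y' \<longleftrightarrow>
     (\<exists>\<alpha>>0. \<exists>g\<in>circuits. y' = y + \<alpha> *\<^sub>R g \<and> (\<forall>\<beta>>\<alpha>. y + \<beta> *\<^sub>R g \<notin> P))"

definition feasible_maximal_circuit_walk ::
    "(real^'n^'m) set \<Rightarrow> real^'n^'m \<Rightarrow> real^'n^'m \<Rightarrow> nat \<Rightarrow> (nat \<Rightarrow> real^'n^'m) \<Rightarrow> bool" where
  "feasible_maximal_circuit_walk P w1 w2 k y \<longleftrightarrow>
     y 0 = w1 \<and> y k = w2 \<and> (\<forall>i\<le>k. y i \<in> P) \<and>
     (\<forall>i<k. maximal_circuit_step P (y i) (y (Suc i)))"

text \<open>The infimum is the minimal length of a walk, and \<open>\<infinity>\<close> if no walk exists.\<close>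

definition CD_fm_dist :: "(real^'n^'m) set \<Rightarrow> real^'n^'m \<Rightarrow> real^'n^'m \<Rightarrow> enat" where
  "CD_fm_dist P w1 w2 = (INF k\<in>{k. \<exists>y. feasible_maximal_circuit_walk P w1 w2 k y}. enat k)"

definition CD_fm :: "(real^'n^'m) set \<Rightarrow> enat" where
  "CD_fm P = (SUP (w1, w2)\<in>{(w1, w2). w1 extreme_point_of P \<and> w2 extreme_point_of P}.
     CD_fm_dist P w1 w2)"

end

theory Submission
  imports Defs
begin

text \<open>A point of the polytope is determined by its first row \<open>x\<close>, which ranges over the slice
  \<open>0 \<le> x \<le> v\<close>, \<open>\<Sum>x = u\<^sub>1\<close> of a box, and the 4-cycles move mass from one coordinate to another. In a
  vertex all coordinates but one lie on the boundary of the box. If \<open>x\<close> differs from a vertex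
  \<open>w\<close>, then among the coordinates where they differ one can choose a donor and a receiver such that
  the maximal step gives one of them its value in \<open>w\<close>. So each step lowers the number of wrong
  coordinates, which is never 1 since the coordinate sums agree: a walk needs at most
  \<open>n - 1\<close> steps, even from an arbitrary starting point.\<close>

section \<open>Exchanges along 4-cycles\<close>

text \<open>For distinct \<open>a\<close> and \<open>b\<close>, the signed 4-cycle through both
  supplies. In the first row \<open>a\<close> receives and \<open>b\<close> donates; the second row
  compensates, which keeps all column sums.\<close>

definition exchange :: "'n \<Rightarrow> 'n \<Rightarrow> real^'n^2" where
  "exchange a b =
     (\<chi> i j. (if i = 1 then 1 else -1) * ((if j = a then 1 else 0) - (if j = b then 1 else 0)))"

lemma exchange_nth:
  "exchange a b $ 1 $ j = (if j = a then 1 else 0) - (if j = b then 1 else 0)"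
  "exchange a b $ 2 $ j = (if j = b then 1 else 0) - (if j = a then 1 else 0)"
  by (simp_all add: exchange_def)

lemma exchange_in_circuits:
  assumes "a \<noteq> b"
  shows "exchange a b \<in> circuits"
proof -
  \<comment> \<open>Starting with the edge from \<open>Supply 1\<close> to \<open>Demand a\<close>
    gives that entry the sign of index 0, which is +1 as in \<open>exchange a b\<close>.\<close>
  define c :: "(2, 'a) node list" where "c = [Supply 1, Demand a, Supply 2, Demand b]"
  have len: "length c = 4" by (simp add: c_def)
  have edges: "cycle_edge c 0 = {Supply 1, Demand a}" "cycle_edge c 1 = {Supply 2, Demand a}"
    "cycle_edge c 2 = {Supply 2, Demand b}" "cycle_edge c 3 = {Supply 1, Demand b}"
    by (simp_all add: cycle_edge_def c_def insert_commute)
  have below_4: "{..<4::nat} = {0, 1, 2, 3}" by auto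
  have "\<forall>k\<in>{..<4}. cycle_edge c k \<in> bipartite_edges"
    unfolding below_4 by (simp only: ball_simps edges) (auto simp: bipartite_edges_def)
  then have "simple_even_cycle c"
    using assms by (simp add: simple_even_cycle_def len) (simp add: c_def)
  moreover have "exchange a b = alternating_vector c"
    using assms unfolding alternating_vector_def len below_4 vec_eq_iff forall_2 exchange_nth
    by (simp add: edges[simplified] doubleton_eq_iff)
  ultimately show ?thesis
    unfolding circuits_def by blast
qed

section \<open>The polytope in terms of its two rows, and maximal steps in it\<close>

lemma transportation_polytope_2_iff:
  fixes u :: "real^2" and v :: "real^'n" and y :: "real^'n^2"
  shows "y \<in> transportation_polytope u v \<longleftrightarrow>
    (\<Sum>j\<in>UNIV. y $ 1 $ j) = u $ 1 \<and> (\<Sum>j\<in>UNIV. y $ 2 $ j) = u $ 2 \<and>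
    (\<forall>j. y $ 1 $ j + y $ 2 $ j = v $ j \<and> 0 \<le> y $ 1 $ j \<and> 0 \<le> y $ 2 $ j)"
  by (auto simp: transportation_polytope_def forall_2 sum_2)

lemma first_row_bounds:
  fixes u :: "real^2" and v :: "real^'n"
  assumes "y \<in> transportation_polytope u v"
  shows "0 \<le> y $ 1 $ j" "y $ 1 $ j \<le> v $ j"
proof -
  have "y $ 1 $ j + y $ 2 $ j = v $ j" "0 \<le> y $ 1 $ j" "0 \<le> y $ 2 $ j"
    using assms by (simp_all add: transportation_polytope_2_iff)
  then show "0 \<le> y $ 1 $ j" "y $ 1 $ j \<le> v $ j" by linarith+
qed

text \<open>An exchange preserves row and column sums, so only nonnegativity can fail. The
  decreasing entries are \<open>y $ 1 $ b\<close> and \<open>y $ 2 $ a\<close>, and the latter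
  equals \<open>v $ a - y $ 1 $ a\<close>.\<close>

lemma exchange_in_polytope_iff:
  fixes u :: "real^2" and v :: "real^'n"
  assumes y: "y \<in> transportation_polytope u v" and "a \<noteq> b" and "0 \<le> \<alpha>"
  shows "y + \<alpha> *\<^sub>R exchange a b \<in> transportation_polytope u v \<longleftrightarrow>
    \<alpha> \<le> v $ a - y $ 1 $ a \<and> \<alpha> \<le> y $ 1 $ b"
proof -
  have sums: "(\<Sum>j\<in>UNIV. (y + \<alpha> *\<^sub>R exchange a b) $ 1 $ j) = (\<Sum>j\<in>UNIV. y $ 1 $ j)"
    "(\<Sum>j\<in>UNIV. (y + \<alpha> *\<^sub>R exchange a b) $ 2 $ j) = (\<Sum>j\<in>UNIV. y $ 2 $ j)"
    by (simp_all add: exchange_nth sum.distrib sum_subtractf flip: sum_distrib_left)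
  have y': "y $ 1 $ j + y $ 2 $ j = v $ j" "0 \<le> y $ 1 $ j" "0 \<le> y $ 2 $ j" for j
    using y by (auto simp: transportation_polytope_2_iff)
  have "(\<forall>j. (y + \<alpha> *\<^sub>R exchange a b) $ 1 $ j + (y + \<alpha> *\<^sub>R exchange a b) $ 2 $ j = v $ j \<and>
      0 \<le> (y + \<alpha> *\<^sub>R exchange a b) $ 1 $ j \<and> 0 \<le> (y + \<alpha> *\<^sub>R exchange a b) $ 2 $ j) \<longleftrightarrow>
    \<alpha> \<le> v $ a - y $ 1 $ a \<and> \<alpha> \<le> y $ 1 $ b" (is "(\<forall>j. ?L j) \<longleftrightarrow> ?R")
  proof
    assume L: "\<forall>j. ?L j"
    have "?L a" "?L b" using L by blast+
    then show ?R using \<open>a \<noteq> b\<close> y'(1)[of a] by (simp add: exchange_nth)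
  next
    assume R: ?R
    show "\<forall>j. ?L j"
    proof
      fix j
      show "?L j"
        using R \<open>a \<noteq> b\<close> \<open>0 \<le> \<alpha>\<close> y'[of j] by (auto simp: exchange_nth)
    qed
  qed
  then show ?thesis
    using y unfolding transportation_polytope_2_iff[of "y + _"] sums
    by (simp add: transportation_polytope_2_iff)
qed

lemma maximal_exchange_step:
  fixes u :: "real^2" and v :: "real^'n"
  assumes y: "y \<in> transportation_polytope u v" and "a \<noteq> b"
    and "y $ 1 $ a < v $ a" and "0 < y $ 1 $ b"
  defines "y' \<equiv> y + min (v $ a - y $ 1 $ a) (y $ 1 $ b) *\<^sub>R exchange a b"
  shows "y' \<in> transportation_polytope u v"
    and "maximal_circuit_step (transportation_polytope u v) y y'"
proof -
  let ?\<alpha> = "min (v $ a - y $ 1 $ a) (y $ 1 $ b)"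
  have pos: "?\<alpha> > 0" using assms by simp
  then show "y' \<in> transportation_polytope u v"
    unfolding y'_def using exchange_in_polytope_iff[OF y \<open>a \<noteq> b\<close>, of ?\<alpha>] by simp
  have "y + \<beta> *\<^sub>R exchange a b \<notin> transportation_polytope u v" if "\<beta> > ?\<alpha>" for \<beta>
    using exchange_in_polytope_iff[OF y \<open>a \<noteq> b\<close>, of \<beta>] pos that by auto
  then show "maximal_circuit_step (transportation_polytope u v) y y'"
    unfolding maximal_circuit_step_def y'_def
    using pos exchange_in_circuits[OF \<open>a \<noteq> b\<close>] by blast
qed

section \<open>Vertices have at most one fractional column\<close>

text \<open>Two columns strictly inside their bounds could exchange mass in both directions, making
  \<open>w\<close> the midpoint of two distinct feasible points.\<close>

lemma extreme_point_fractional_unique: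
  fixes u :: "real^2" and v :: "real^'n"
  assumes w: "w extreme_point_of transportation_polytope u v"
    and a: "w $ 1 $ a \<noteq> 0" "w $ 1 $ a \<noteq> v $ a"
    and b: "w $ 1 $ b \<noteq> 0" "w $ 1 $ b \<noteq> v $ b"
  shows "a = b"
proof (rule ccontr)
  assume "a \<noteq> b"
  let ?P = "transportation_polytope u v"
  have wP: "w \<in> ?P" using w by (simp add: extreme_point_of_def)
  have bounds: "0 < w $ 1 $ j" "w $ 1 $ j < v $ j" if "w $ 1 $ j \<noteq> 0" "w $ 1 $ j \<noteq> v $ j" for j
    using first_row_bounds[OF wP, of j] that by linarith+
  \<comment> \<open>The smallest of the slacks that limit the exchange in either direction.\<close>
  define \<epsilon> where "\<epsilon> = Min {w $ 1 $ a, v $ a - w $ 1 $ a, w $ 1 $ b, v $ b - w $ 1 $ b}"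
  have \<epsilon>: "0 < \<epsilon>" "\<epsilon> \<le> w $ 1 $ a" "\<epsilon> \<le> v $ a - w $ 1 $ a" "\<epsilon> \<le> w $ 1 $ b" "\<epsilon> \<le> v $ b - w $ 1 $ b"
    using bounds[OF a] bounds[OF b] unfolding \<epsilon>_def by auto
  have opp: "exchange b a = - exchange a b"
    by (simp add: vec_eq_iff exchange_def)
  have "w + \<epsilon> *\<^sub>R exchange a b \<in> ?P" "w + \<epsilon> *\<^sub>R exchange b a \<in> ?P"
    using exchange_in_polytope_iff[OF wP \<open>a \<noteq> b\<close>, of \<epsilon>]
      exchange_in_polytope_iff[OF wP \<open>a \<noteq> b\<close>[symmetric], of \<epsilon>] \<epsilon> by auto
  moreover have "w + \<epsilon> *\<^sub>R exchange a b \<noteq> w + \<epsilon> *\<^sub>R exchange b a"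
  proof
    assume "w + \<epsilon> *\<^sub>R exchange a b = w + \<epsilon> *\<^sub>R exchange b a"
    then have "exchange a b $ 1 $ a = exchange b a $ 1 $ a" using \<epsilon>(1) by simp
    then show False using \<open>a \<noteq> b\<close> by (simp add: exchange_nth)
  qed
  moreover have "midpoint (w + \<epsilon> *\<^sub>R exchange a b) (w + \<epsilon> *\<^sub>R exchange b a) = w"
    by (simp add: opp midpoint_def flip: scaleR_2)
  ultimately show False
    using w unfolding extreme_point_of_def by (metis midpoint_in_open_segment)
qed

section \<open>Progress towards a vertex\<close>

definition wrong_columns :: "real^'n^2 \<Rightarrow> real^'n^2 \<Rightarrow> 'n set" where
  "wrong_columns w y = {j. y $ 1 $ j \<noteq> w $ 1 $ j}"

lemma wrong_columns_empty_imp_eq: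
  fixes u :: "real^2" and v :: "real^'n"
  assumes "y \<in> transportation_polytope u v" "w \<in> transportation_polytope u v"
    and "wrong_columns w y = {}"
  shows "y = w"
proof -
  have "y $ 1 $ j = w $ 1 $ j" for j
    using assms(3) by (auto simp: wrong_columns_def)
  moreover from this have "y $ 2 $ j = w $ 2 $ j" for j
    using assms(1,2) unfolding transportation_polytope_2_iff by (metis add_left_cancel)
  ultimately show ?thesis by (simp add: vec_eq_iff forall_2)
qed

text \<open>The disjunction says that the bound reached first by the maximal exchange is the value
  in \<open>w\<close>: column \<open>a\<close> becomes full, or column \<open>b\<close> becomes
  empty, just as \<open>w\<close> requires.\<close>

lemma wrong_columns_donor_receiver:
  fixes u :: "real^2" and v :: "real^'n"
  assumes y: "y \<in> transportation_polytope u v"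
    and w: "w extreme_point_of transportation_polytope u v" and "y \<noteq> w"
  obtains a b where "y $ 1 $ a < w $ 1 $ a" "w $ 1 $ b < y $ 1 $ b"
    "w $ 1 $ a = v $ a \<and> v $ a - y $ 1 $ a \<le> y $ 1 $ b \<or>
     w $ 1 $ b = 0 \<and> y $ 1 $ b \<le> v $ a - y $ 1 $ a"
proof -
  have wP: "w \<in> transportation_polytope u v" using w by (simp add: extreme_point_of_def)
  note bounds = first_row_bounds[OF wP]
  define A where "A = {j. y $ 1 $ j < w $ 1 $ j}"
  define B where "B = {j. w $ 1 $ j < y $ 1 $ j}"
  \<comment> \<open>The total deficit of the receivers \<open>A\<close> equals the total excess of
    the donors \<open>B\<close>.\<close>
  have sums: "(\<Sum>j\<in>A. w $ 1 $ j - y $ 1 $ j) = (\<Sum>j\<in>B. y $ 1 $ j - w $ 1 $ j)"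
  proof -
    have "0 = (\<Sum>j\<in>UNIV. w $ 1 $ j - y $ 1 $ j)"
      using y wP by (simp add: transportation_polytope_2_iff sum_subtractf)
    also have "\<dots> = (\<Sum>j\<in>A \<union> B. w $ 1 $ j - y $ 1 $ j)"
      by (rule sum.mono_neutral_right) (auto simp: A_def B_def)
    also have "\<dots> = (\<Sum>j\<in>A. w $ 1 $ j - y $ 1 $ j) + (\<Sum>j\<in>B. w $ 1 $ j - y $ 1 $ j)"
      by (rule sum.union_disjoint) (auto simp: A_def B_def)
    finally show ?thesis by (simp add: sum_subtractf)
  qed
  have "A \<union> B \<noteq> {}"
    using wrong_columns_empty_imp_eq[OF y wP] \<open>y \<noteq> w\<close>
    by (auto simp: wrong_columns_def A_def B_def neq_iff)
  moreover have "A = {} \<longleftrightarrow> B = {}"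
  proof -
    have "0 < (\<Sum>j\<in>A. w $ 1 $ j - y $ 1 $ j)" if "A \<noteq> {}"
      using that by (intro sum_pos) (auto simp: A_def)
    moreover have "0 < (\<Sum>j\<in>B. y $ 1 $ j - w $ 1 $ j)" if "B \<noteq> {}"
      using that by (intro sum_pos) (auto simp: B_def)
    ultimately show ?thesis using sums by fastforce
  qed
  ultimately obtain a0 b0 where ab0: "a0 \<in> A" "b0 \<in> B" by blast
  show ?thesis
  \<comment> \<open>If \<open>w\<close> is full at \<open>a\<close> and empty at \<open>b\<close>,
    either bound is the right one to reach first.\<close>
  proof (cases "\<exists>a\<in>A. \<exists>b\<in>B. w $ 1 $ a = v $ a \<and> w $ 1 $ b = 0")
    case True
    then show ?thesis using that by (force simp: A_def B_def)
  next
    case False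
    \<comment> \<open>One of the two sides consists of the single fractional coordinate of \<open>w\<close>, which then has room
      for everything that the other side has to exchange.\<close>
    have fixed: "w $ 1 $ j = 0 \<or> w $ 1 $ j = v $ j" if "w $ 1 $ k \<noteq> 0" "w $ 1 $ k \<noteq> v $ k" "j \<noteq> k" for j k
      using extreme_point_fractional_unique[OF w, of j k] that by blast
    have Apos: "w $ 1 $ j \<noteq> 0" if "j \<in> A" for j
      using that first_row_bounds(1)[OF y, of j] by (simp add: A_def)
    have Bless: "w $ 1 $ j \<noteq> v $ j" if "j \<in> B" for j
      using that first_row_bounds(2)[OF y, of j] by (simp add: B_def)
    have disj: "A \<inter> B = {}" by (auto simp: A_def B_def)
    show ?thesis
    proof (cases "w $ 1 $ a0 = v $ a0")
      case True
      then have "w $ 1 $ b0 \<noteq> 0" using False ab0 by blast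
      \<comment> \<open>Here \<open>b0\<close> is the fractional column of \<open>w\<close>, so any
        other donor would be empty in \<open>w\<close> and form with \<open>a0\<close> the excluded
        pair.\<close>
      then have "j = b0" if "j \<in> B" for j
        using fixed[of b0 j] Bless ab0 that False True by blast
      then have "B = {b0}" using ab0 by blast
      then have "w $ 1 $ a0 - y $ 1 $ a0 \<le> y $ 1 $ b0 - w $ 1 $ b0"
        using sums member_le_sum[of a0 A "\<lambda>j. w $ 1 $ j - y $ 1 $ j"] ab0 by (simp add: A_def)
      then show ?thesis
        using that[of a0 b0] ab0 True bounds(1)[of b0] by (simp add: A_def B_def)
    next
      case frac: False
      have b00: "w $ 1 $ b0 = 0"
        using fixed[of a0 b0] Apos Bless ab0 frac disj by blast
      have "j = a0" if "j \<in> A" for j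
        using fixed[of a0 j] Apos ab0 that False frac b00 by blast
      then have "A = {a0}" using ab0 by blast
      then have "y $ 1 $ b0 - w $ 1 $ b0 \<le> w $ 1 $ a0 - y $ 1 $ a0"
        using sums member_le_sum[of b0 B "\<lambda>j. y $ 1 $ j - w $ 1 $ j"] ab0 by (simp add: B_def)
      then show ?thesis
        using that[of a0 b0] ab0 b00 bounds(2)[of a0] by (simp add: A_def B_def)
    qed
  qed
qed

text \<open>The exchange changes only \<open>a\<close> and \<open>b\<close>, both wrong before, and
  corrects at least one of them. These two columns also give the lower bound 2, which saves one step
  in the final count.\<close>

lemma improving_step:
  fixes u :: "real^2" and v :: "real^'n"
  assumes y: "y \<in> transportation_polytope u v"
    and w: "w extreme_point_of transportation_polytope u v" and "y \<noteq> w"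
  obtains y' where "y' \<in> transportation_polytope u v"
    "maximal_circuit_step (transportation_polytope u v) y y'"
    "wrong_columns w y' \<subset> wrong_columns w y" "2 \<le> card (wrong_columns w y)"
proof -
  obtain a b where ab: "y $ 1 $ a < w $ 1 $ a" "w $ 1 $ b < y $ 1 $ b"
    "w $ 1 $ a = v $ a \<and> v $ a - y $ 1 $ a \<le> y $ 1 $ b \<or>
     w $ 1 $ b = 0 \<and> y $ 1 $ b \<le> v $ a - y $ 1 $ a"
    using wrong_columns_donor_receiver[OF y w \<open>y \<noteq> w\<close>] by blast
  have "w \<in> transportation_polytope u v" using w by (simp add: extreme_point_of_def)
  then have less: "y $ 1 $ a < v $ a" "0 < y $ 1 $ b"
    using first_row_bounds(2)[of w u v a] first_row_bounds(1)[of w u v b] ab by linarith+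
  have "a \<noteq> b" using ab by auto
  let ?y = "y + min (v $ a - y $ 1 $ a) (y $ 1 $ b) *\<^sub>R exchange a b"
  have in_wrong: "{a, b} \<subseteq> wrong_columns w y" using ab by (auto simp: wrong_columns_def)
  then have "card {a, b} \<le> card (wrong_columns w y)" by (intro card_mono) auto
  then have "2 \<le> card (wrong_columns w y)" using \<open>a \<noteq> b\<close> by simp
  moreover have "wrong_columns w ?y \<subseteq> wrong_columns w y"
    using in_wrong by (auto simp: wrong_columns_def exchange_nth)
  moreover have "a \<notin> wrong_columns w ?y \<or> b \<notin> wrong_columns w ?y"
    using ab \<open>a \<noteq> b\<close> by (auto simp: wrong_columns_def exchange_nth min_def)
  ultimately show ?thesis
    using that[of ?y] maximal_exchange_step[OF y \<open>a \<noteq> b\<close> less] in_wrong by blast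
qed

section \<open>Assembling walks and bounding the diameter\<close>

lemma feasible_maximal_circuit_walk_Suc:
  assumes "y \<in> P" "maximal_circuit_step P y y'" "feasible_maximal_circuit_walk P y' w k z"
  shows "feasible_maximal_circuit_walk P y w (Suc k) (case_nat y z)"
  using assms unfolding feasible_maximal_circuit_walk_def by (auto split: nat.split)

lemma short_walk_exists:
  fixes u :: "real^2" and v :: "real^'n"
  assumes "y \<in> transportation_polytope u v"
    and w: "w extreme_point_of transportation_polytope u v"
  shows "\<exists>k z. k \<le> card (wrong_columns w y) - 1 \<and>
    feasible_maximal_circuit_walk (transportation_polytope u v) y w k z"
  using assms(1)
proof (induction "card (wrong_columns w y)" arbitrary: y rule: less_induct)
  case less
  show ?case
  proof (cases "y = w")
    case True
    then have "feasible_maximal_circuit_walk (transportation_polytope u v) y w 0 (\<lambda>_. w)"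
      using less.prems by (simp add: feasible_maximal_circuit_walk_def)
    then show ?thesis by blast
  next
    case False
    then obtain y' where y': "y' \<in> transportation_polytope u v"
      "maximal_circuit_step (transportation_polytope u v) y y'"
      "wrong_columns w y' \<subset> wrong_columns w y" "2 \<le> card (wrong_columns w y)"
      using improving_step[OF less.prems w] by blast
    have smaller: "card (wrong_columns w y') < card (wrong_columns w y)"
      using y'(3) by (intro psubset_card_mono) auto
    obtain k z where kz: "k \<le> card (wrong_columns w y') - 1"
      "feasible_maximal_circuit_walk (transportation_polytope u v) y' w k z"
      using less.hyps[OF smaller y'(1)] by blast
    \<comment> \<open>If \<open>y'\<close> has no wrong column, truncated subtraction gives
      \<open>k = 0\<close>, and the single step fits because \<open>y\<close> has at least two wrong
      columns.\<close>
    have "Suc k \<le> card (wrong_columns w y) - 1" using kz(1) smaller y'(4) by linarith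
    then show ?thesis
      using feasible_maximal_circuit_walk_Suc[OF less.prems y'(2) kz(2)] by blast
  qed
qed

theorem theorem2:
  fixes u :: "real^2" and v :: "real^'n"
  assumes "\<And>i. u $ i > 0"
    and "\<And>j. v $ j > 0"
    and "u $ 1 + u $ 2 = (\<Sum>j\<in>UNIV. v $ j)"
  shows "CD_fm (transportation_polytope u v) \<le> enat (CARD('n) - 1)"
proof -
  let ?P = "transportation_polytope u v"
  have "CD_fm_dist ?P w1 w2 \<le> enat (CARD('n) - 1)"
    if w1: "w1 extreme_point_of ?P" and w2: "w2 extreme_point_of ?P" for w1 w2
  proof -
    have "w1 \<in> ?P" using w1 by (simp add: extreme_point_of_def)
    then obtain k z where k: "k \<le> card (wrong_columns w2 w1) - 1"
      and walk: "feasible_maximal_circuit_walk ?P w1 w2 k z"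
      using short_walk_exists[OF _ w2] by blast
    have "card (wrong_columns w2 w1) \<le> CARD('n)" by (intro card_mono) auto
    then have "enat k \<le> enat (CARD('n) - 1)" using k by simp
    \<comment> \<open>The length of any one walk bounds the infimum, which is therefore
      finite.\<close>
    moreover have "CD_fm_dist ?P w1 w2 \<le> enat k"
      unfolding CD_fm_dist_def using walk by (intro INF_lower) blast
    ultimately show ?thesis by (rule order_trans[rotated])
  qed
  then show ?thesis
    unfolding CD_fm_def by (auto intro!: SUP_least)
qed

end
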